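(* Let $X$ be a path-connected and locally path-connected topological space whose fundamental group (at any point) does not have the group of integers $\mathbb{Z}$ as a retract. Then $X$ has the Phragmen-Brouwer Property.
   Context: A group $F$ is a retract of a group $H$ if there are group homomorphisms $\iota : F \to H$ and $\rho : H \to F$ with $\rho\iota = 1_F$. A topological space $X$ has the Phragmen-Brouwer Property (PBP) if $X$ is connected and the following holds: if $D$ and $E$ are disjoint closed subsets of $X$, and if $a$ and $b$ are points in $X \setminus (D \cup E)$ which lie in the same connected component of $X \setminus D$ and in the same connected component of $X \setminus E$, then $a$ and $b$ lie in the same connected component of $X \setminus (D \cup E)$. *)

theory Defs
  imports "HOL-Analysis.Analysis" "HOL-Algebra.Elementary_Groups"
begin

section \<open>The fundamental group\<close>

text \<open>The library's \<open>homotopic_paths\<close> and \<open>joinpaths\<close> are restricted to types of class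
  \<open>topological_space\<close>; the following are their counterparts for an arbitrary
  \<open>'a topology\<close>. As there, a path is a function on all of \<open>real\<close> of which only
  the values on \<open>{0..1}\<close> matter: paths agreeing on \<open>{0..1}\<close> are path homotopic.\<close>

definition path_homotopic :: "'a topology \<Rightarrow> (real \<Rightarrow> 'a) \<Rightarrow> (real \<Rightarrow> 'a) \<Rightarrow> bool" where
  "path_homotopic X p q \<longleftrightarrow>
     homotopic_with (\<lambda>r. r 0 = p 0 \<and> r 1 = p 1) (top_of_set {0..1}) X p q"

definition join_paths :: "(real \<Rightarrow> 'a) \<Rightarrow> (real \<Rightarrow> 'a) \<Rightarrow> real \<Rightarrow> 'a" where
  "join_paths p q = (\<lambda>t. if t \<le> 1/2 then p (2 * t) else q (2 * t - 1))"

definition loops_at :: "'a topology \<Rightarrow> 'a \<Rightarrow> (real \<Rightarrow> 'a) set" where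
  "loops_at X x = {p. pathin X p \<and> p 0 = x \<and> p 1 = x}"

definition loop_rel :: "'a topology \<Rightarrow> 'a \<Rightarrow> ((real \<Rightarrow> 'a) \<times> (real \<Rightarrow> 'a)) set" where
  "loop_rel X x = {(p, q). p \<in> loops_at X x \<and> q \<in> loops_at X x \<and> path_homotopic X p q}"

definition fundamental_group :: "'a topology \<Rightarrow> 'a \<Rightarrow> (real \<Rightarrow> 'a) set monoid" where
  "fundamental_group X x =
     \<lparr>carrier = loops_at X x // loop_rel X x,
      monoid.mult = (\<lambda>A B. \<Union>p\<in>A. \<Union>q\<in>B. loop_rel X x `` {join_paths p q}),
      one = loop_rel X x `` {\<lambda>_. x}\<rparr>"


section \<open>Retracts of groups and the Phragmen-Brouwer Property\<close>

text \<open>Intended for groups \<open>F\<close> and \<open>H\<close>, so that \<open>hom\<close> consists of group homomorphisms;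
  \<open>group_fundamental_group\<close> below provides this for the fundamental group.\<close>

definition group_retract_of :: "('a, 'c) monoid_scheme \<Rightarrow> ('b, 'd) monoid_scheme \<Rightarrow> bool" where
  "group_retract_of F H \<longleftrightarrow>
     (\<exists>i \<in> hom F H. \<exists>r \<in> hom H F. \<forall>z \<in> carrier F. r (i z) = z)"

definition phragmen_brouwer :: "'a topology \<Rightarrow> bool" where
  "phragmen_brouwer X \<longleftrightarrow>
     connected_space X \<and>
     (\<forall>D E a b.
        closedin X D \<and> closedin X E \<and> D \<inter> E = {} \<and>
        a \<in> topspace X - (D \<union> E) \<and> b \<in> topspace X - (D \<union> E) \<and>
        connected_component_of (subtopology X (topspace X - D)) a b \<and>
        connected_component_of (subtopology X (topspace X - E)) a b
        \<longrightarrow> connected_component_of (subtopology X (topspace X - (D \<union> E))) a b)"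


section \<open>The fundamental group is a group\<close>

lemma path_homotopic:
  "path_homotopic X p q \<longleftrightarrow>
     (\<exists>h. continuous_map (prod_topology (top_of_set {0..1::real}) (top_of_set {0..1::real})) X h \<and>
          (\<forall>s\<in>{0..1}. h (0, s) = p s) \<and> (\<forall>s\<in>{0..1}. h (1, s) = q s) \<and>
          (\<forall>t\<in>{0..1}. h (t, 0) = p 0 \<and> h (t, 1) = p 1))"
  unfolding path_homotopic_def by (subst homotopic_with) auto

lemma path_homotopic_imp:
  assumes "path_homotopic X p q"
  shows "pathin X p" "pathin X q" "q 0 = p 0" "q 1 = p 1"
proof -
  show "pathin X p" "pathin X q"
    using assms homotopic_with_imp_continuous_maps
    unfolding path_homotopic_def pathin_def by blast+
  show "q 0 = p 0" "q 1 = p 1"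
    using assms homotopic_with_imp_property
    unfolding path_homotopic_def by blast+
qed

lemma path_homotopic_refl: "pathin X p \<Longrightarrow> path_homotopic X p p"
  unfolding path_homotopic_def pathin_def by simp

lemma path_homotopic_sym:
  assumes "path_homotopic X p q"
  shows "path_homotopic X q p"
  using homotopic_with_symD[OF assms[unfolded path_homotopic_def]]
  unfolding path_homotopic_def path_homotopic_imp(3,4)[OF assms] .

lemma path_homotopic_trans:
  assumes "path_homotopic X p q" "path_homotopic X q r"
  shows "path_homotopic X p r"
  using homotopic_with_trans[OF assms(1)[unfolded path_homotopic_def]
      assms(2)[unfolded path_homotopic_def path_homotopic_imp(3,4)[OF assms(1)]]]
  unfolding path_homotopic_def .

lemma path_homotopic_reparam:
  assumes p: "pathin X p"
    and f: "continuous_on {0..1} f" "f \<in> {0..1} \<rightarrow> {0..1}"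
    and g: "continuous_on {0..1} g" "g \<in> {0..1} \<rightarrow> {0..1}"
    and ends: "f 0 = g 0" "f 1 = g (1::real)"
    and q: "\<And>s. s \<in> {0..1} \<Longrightarrow> q s = p (f s)"
    and r: "\<And>s. s \<in> {0..1} \<Longrightarrow> r s = p (g s)"
  shows "path_homotopic X q r"
proof -
  define k where "k = (\<lambda>(t, s). (1 - t) * f s + t * g s)"
  have "continuous_on ({0..1} \<times> {0..1}) k"
    unfolding k_def case_prod_beta
    by (intro continuous_intros continuous_on_compose2[OF f(1)] continuous_on_compose2[OF g(1)]) auto
  moreover have "k ` ({0..1} \<times> {0..1}) \<subseteq> {0..1}"
  proof clarify
    fix t s :: real assume ts: "t \<in> {0..1}" "s \<in> {0..1}"
    then have "f s \<in> {0..1}" "g s \<in> {0..1}" using f g by auto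
    then have "(1 - t) *\<^sub>R f s + t *\<^sub>R g s \<in> {0..1}"
      using ts by (intro convexD[OF convex_real_interval(5)]) auto
    then show "k (t, s) \<in> {0..1}" by (simp add: k_def)
  qed
  ultimately have "continuous_map (prod_topology (top_of_set {0..1}) (top_of_set {0..1}))
                     (top_of_set {0..1}) k"
    by (simp add: continuous_map_in_subtopology continuous_map_iff_continuous2 image_subset_iff_funcset
        flip: subtopology_Times)
  then have "continuous_map (prod_topology (top_of_set {0..1}) (top_of_set {0..1})) X (p \<circ> k)"
    using p unfolding pathin_def by (rule continuous_map_compose)
  then show ?thesis
    unfolding path_homotopic using ends
    by (intro exI[of _ "p \<circ> k"]) (auto simp: k_def q r algebra_simps)
qed

lemma path_homotopic_join:
  assumes h1: "path_homotopic X p p'" and h2: "path_homotopic X q q'" and e: "p 1 = q 0"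
  shows "path_homotopic X (join_paths p q) (join_paths p' q')"
proof -
  let ?I = "top_of_set {0..1::real}"
  obtain h where h: "continuous_map (prod_topology ?I ?I) X h"
    "\<And>s. s\<in>{0..1} \<Longrightarrow> h (0, s) = p s" "\<And>s. s\<in>{0..1} \<Longrightarrow> h (1, s) = p' s"
    "\<And>t. t\<in>{0..1} \<Longrightarrow> h (t, 0) = p 0" "\<And>t. t\<in>{0..1} \<Longrightarrow> h (t, 1) = p 1"
    using h1 unfolding path_homotopic by blast
  obtain k where k: "continuous_map (prod_topology ?I ?I) X k"
    "\<And>s. s\<in>{0..1} \<Longrightarrow> k (0, s) = q s" "\<And>s. s\<in>{0..1} \<Longrightarrow> k (1, s) = q' s"
    "\<And>t. t\<in>{0..1} \<Longrightarrow> k (t, 0) = q 0" "\<And>t. t\<in>{0..1} \<Longrightarrow> k (t, 1) = q 1"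
    using h2 unfolding path_homotopic by blast
  define m where "m = (\<lambda>z::real \<times> real. if snd z \<le> 1/2 then h (fst z, 2 * snd z)
                                           else k (fst z, 2 * snd z - 1))"
  have sq: "prod_topology ?I ?I = top_of_set ({0..1} \<times> {0..1})"
    by (simp flip: subtopology_Times)
  have "continuous_map (prod_topology ?I ?I) X m"
    unfolding m_def
  proof (rule continuous_map_cases_le)
    show "continuous_map (prod_topology ?I ?I) euclideanreal snd"
      unfolding sq by (simp add: continuous_on_snd)
    show "continuous_map (prod_topology ?I ?I) euclideanreal (\<lambda>z. 1/2)" by simp
    have "continuous_map (subtopology (prod_topology ?I ?I)
            {x \<in> topspace (prod_topology ?I ?I). snd x \<le> 1 / 2})
            (prod_topology ?I ?I) (\<lambda>z. (fst z, 2 * snd z))"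
      unfolding sq subtopology_subtopology
      by (auto simp: continuous_map_in_subtopology continuous_map_iff_continuous2 intro!: continuous_intros)
    from continuous_map_compose[OF this h(1)]
    show "continuous_map (subtopology (prod_topology ?I ?I)
            {x \<in> topspace (prod_topology ?I ?I). snd x \<le> 1 / 2}) X (\<lambda>z. h (fst z, 2 * snd z))"
      by (simp add: o_def)
    have "continuous_map (subtopology (prod_topology ?I ?I)
            {x \<in> topspace (prod_topology ?I ?I). 1 / 2 \<le> snd x})
            (prod_topology ?I ?I) (\<lambda>z. (fst z, 2 * snd z - 1))"
      unfolding sq subtopology_subtopology
      by (auto simp: continuous_map_in_subtopology continuous_map_iff_continuous2 intro!: continuous_intros)
    from continuous_map_compose[OF this k(1)]
    show "continuous_map (subtopology (prod_topology ?I ?I)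
            {x \<in> topspace (prod_topology ?I ?I). 1 / 2 \<le> snd x}) X (\<lambda>z. k (fst z, 2 * snd z - 1))"
      by (simp add: o_def)
    show "h (fst z, 2 * snd z) = k (fst z, 2 * snd z - 1)"
      if "z \<in> topspace (prod_topology ?I ?I)" "snd z = 1/2" for z
    proof -
      have "fst z \<in> {0..1}" "2 * snd z = 1" using that by auto
      then show ?thesis using e h(5) k(4) by simp
    qed
  qed
  then show ?thesis
    unfolding path_homotopic
    by (intro exI[of _ m]) (auto simp: m_def join_paths_def h k)
qed

lemma pathin_join:
  assumes "pathin X p" "pathin X q" "p 1 = q 0"
  shows "pathin X (join_paths p q)"
  using path_homotopic_join[of X p p q q] assms path_homotopic_refl path_homotopic_imp(1) by blast

lemma join_in_loops:
  "\<lbrakk>p \<in> loops_at X x; q \<in> loops_at X x\<rbrakk> \<Longrightarrow> join_paths p q \<in> loops_at X x"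
  by (auto simp: loops_at_def pathin_join) (auto simp: join_paths_def)

lemma const_in_loops: "x \<in> topspace X \<Longrightarrow> (\<lambda>_. x) \<in> loops_at X x"
  by (simp add: loops_at_def pathin_def)

lemma equiv_loop_rel: "equiv (loops_at X x) (loop_rel X x)"
proof (rule equivI)
  show "loop_rel X x \<subseteq> loops_at X x \<times> loops_at X x"
    by (auto simp: loop_rel_def)
  show "refl_on (loops_at X x) (loop_rel X x)"
    by (auto simp: refl_on_def loop_rel_def loops_at_def path_homotopic_refl)
  show "sym (loop_rel X x)"
    by (auto simp: sym_def loop_rel_def path_homotopic_sym)
  show "trans (loop_rel X x)"
    by (auto simp: trans_def loop_rel_def intro: path_homotopic_trans)
qed

lemma loop_class_eq:
  "\<lbrakk>p \<in> loops_at X x; q \<in> loops_at X x; path_homotopic X p q\<rbrakk>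
     \<Longrightarrow> loop_rel X x `` {p} = loop_rel X x `` {q}"
  by (rule equiv_class_eq[OF equiv_loop_rel]) (simp add: loop_rel_def)

lemma fundamental_group_mult:
  assumes "p \<in> loops_at X x" "q \<in> loops_at X x"
  shows "loop_rel X x `` {p} \<otimes>\<^bsub>fundamental_group X x\<^esub> loop_rel X x `` {q}
         = loop_rel X x `` {join_paths p q}"
proof -
  have "congruent2 (loop_rel X x) (loop_rel X x) (\<lambda>p q. loop_rel X x `` {join_paths p q})"
  proof (rule congruent2I', rule loop_class_eq)
    fix p p' q q'
    assume "(p, p') \<in> loop_rel X x" "(q, q') \<in> loop_rel X x"
    then show "join_paths p q \<in> loops_at X x" "join_paths p' q' \<in> loops_at X x"
      and "path_homotopic X (join_paths p q) (join_paths p' q')"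
      by (simp_all add: loop_rel_def join_in_loops)
         (simp add: loops_at_def path_homotopic_join)
  qed
  then show ?thesis
    using UN_equiv_class2[OF equiv_loop_rel equiv_loop_rel _ assms]
    by (simp add: fundamental_group_def)
qed

lemma group_fundamental_group:
  assumes x: "x \<in> topspace X"
  shows "group (fundamental_group X x)"
proof (rule groupI)
  let ?G = "fundamental_group X x"
  let ?c = "\<lambda>p. loop_rel X x `` {p}"
  have car: "\<exists>p\<in>loops_at X x. A = ?c p" if "A \<in> carrier ?G" for A
    using that by (auto simp: fundamental_group_def quotient_def)
  have inc: "?c p \<in> carrier ?G" if "p \<in> loops_at X x" for p
    using that by (auto simp: fundamental_group_def quotient_def)
  have one: "\<one>\<^bsub>?G\<^esub> = ?c (\<lambda>_. x)" by (simp add: fundamental_group_def)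
  show "A \<otimes>\<^bsub>?G\<^esub> B \<in> carrier ?G" if "A \<in> carrier ?G" "B \<in> carrier ?G" for A B
    using car[OF that(1)] car[OF that(2)] by (auto simp: fundamental_group_mult inc join_in_loops)
  show "\<one>\<^bsub>?G\<^esub> \<in> carrier ?G" by (simp add: one inc const_in_loops x)
  show "A \<otimes>\<^bsub>?G\<^esub> B \<otimes>\<^bsub>?G\<^esub> C = A \<otimes>\<^bsub>?G\<^esub> (B \<otimes>\<^bsub>?G\<^esub> C)"
    if ABC: "A \<in> carrier ?G" "B \<in> carrier ?G" "C \<in> carrier ?G" for A B C
  proof -
    obtain p q r where pqr: "p \<in> loops_at X x" "q \<in> loops_at X x" "r \<in> loops_at X x"
      and [simp]: "A = ?c p" "B = ?c q" "C = ?c r"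
      using car[OF ABC(1)] car[OF ABC(2)] car[OF ABC(3)] by blast
    let ?s = "join_paths p (join_paths q r)"
    have "path_homotopic X (join_paths (join_paths p q) r) ?s"
    proof (rule path_homotopic_reparam[where p = ?s and g = "\<lambda>t. t"
            and f = "\<lambda>t. min (2*t) (min (t + 1/4) ((t + 1)/2))"])
      have "?s \<in> loops_at X x" by (simp add: join_in_loops pqr)
      then show "pathin X ?s" by (simp add: loops_at_def)
      show "join_paths (join_paths p q) r t = ?s (min (2*t) (min (t + 1/4) ((t + 1)/2)))"
        if "t \<in> {0..1}" for t
      proof -
        consider "t \<le> 1/4" | "1/4 < t" "t \<le> 1/2" | "1/2 < t" by linarith
        then show ?thesis
        proof cases
          case 1
          then have "min (2*t) (min (t + 1/4) ((t + 1)/2)) = 2*t" by auto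
          then show ?thesis using 1 by (simp add: join_paths_def)
        next
          case 2
          then have "min (2*t) (min (t + 1/4) ((t + 1)/2)) = t + 1/4" by auto
          then show ?thesis using 2 by (simp add: join_paths_def algebra_simps)
        next
          case 3
          then have "min (2*t) (min (t + 1/4) ((t + 1)/2)) = (t + 1)/2" by auto
          then show ?thesis using 3 by (simp add: join_paths_def field_simps)
        qed
      qed
    qed (auto intro!: continuous_intros simp: min_le_iff_disj)
    then show ?thesis
      by (simp add: fundamental_group_mult join_in_loops pqr loop_class_eq)
  qed
  show "\<one>\<^bsub>?G\<^esub> \<otimes>\<^bsub>?G\<^esub> A = A" if "A \<in> carrier ?G" for A
  proof -
    obtain p where p: "p \<in> loops_at X x" and [simp]: "A = ?c p" using car \<open>A \<in> carrier ?G\<close> by blast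
    have "path_homotopic X (join_paths (\<lambda>_. x) p) p"
    proof (rule path_homotopic_reparam[where p = p and g = "\<lambda>t. t" and f = "\<lambda>t. max 0 (2*t - 1)"])
      show "join_paths (\<lambda>_. x) p t = p (max 0 (2*t - 1))" for t
        using p by (cases "t \<le> 1/2") (simp_all add: join_paths_def loops_at_def max_absorb1 max_absorb2)
    qed (use p in \<open>auto simp: loops_at_def intro!: continuous_intros\<close>)
    then show ?thesis
      by (simp add: one fundamental_group_mult join_in_loops p x const_in_loops loop_class_eq)
  qed
  show "\<exists>B\<in>carrier ?G. B \<otimes>\<^bsub>?G\<^esub> A = \<one>\<^bsub>?G\<^esub>" if "A \<in> carrier ?G" for A
  proof -
    obtain p where p: "p \<in> loops_at X x" and [simp]: "A = ?c p" using car \<open>A \<in> carrier ?G\<close> by blast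
    define q where "q = (\<lambda>t. p (1 - t))"
    have "path_homotopic X q q"
      by (rule path_homotopic_reparam[where p = p and g = "\<lambda>t. 1 - t" and f = "\<lambda>t. 1 - t"])
         (use p in \<open>auto simp: loops_at_def q_def intro!: continuous_intros\<close>)
    then have q: "q \<in> loops_at X x"
      using p path_homotopic_imp(1) by (auto simp: loops_at_def q_def)
    have "path_homotopic X (join_paths q p) (\<lambda>_. x)"
      by (rule path_homotopic_reparam[where p = p and g = "\<lambda>_. 1" and f = "\<lambda>t. \<bar>1 - 2*t\<bar>"])
         (use p in \<open>auto simp: loops_at_def join_paths_def q_def intro!: continuous_intros\<close>)
    then have "?c q \<otimes>\<^bsub>?G\<^esub> A = \<one>\<^bsub>?G\<^esub>"
      by (simp add: one fundamental_group_mult join_in_loops p q x const_in_loops loop_class_eq)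
    then show ?thesis using inc q by blast
  qed
qed

end

theory Submission
  imports Defs
begin

text \<open>If the Phragmen-Brouwer Property fails for \<open>D\<close>, \<open>E\<close>, \<open>a\<close>, \<open>b\<close>, then \<open>U = X - D\<close> and
  \<open>V = X - E\<close> form an open cover of \<open>X\<close>, and the component \<open>A\<close> of \<open>a\<close> in \<open>U \<inter> V\<close> is clopen there
  and omits \<open>b\<close>. The indicator of \<open>A\<close> is a Cech 1-cocycle with values in the integers; it defines
  an infinite cyclic covering of \<open>X\<close>, and path lifting gives a homomorphism from the fundamental
  group to the integers. It sends the loop that runs from \<open>a\<close> to \<open>b\<close> in \<open>U\<close> and back in \<open>V\<close> to 1,
  and so it splits.\<close>

section \<open>Continuity lemmas for sheet numbers\<close>

text \<open>Distinct integers are at distance at least 1, so the range is discrete.\<close>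

lemma constant_on_connected_Ints:
  fixes g :: "'b::topological_space \<Rightarrow> real"
  assumes "connected Y" "continuous_on Y g" "\<And>y. y \<in> Y \<Longrightarrow> g y \<in> \<int>"
    and "x \<in> Y" "y \<in> Y"
  shows "g x = g y"
proof -
  have "\<exists>e>0. \<forall>y. y \<in> Y \<and> g y \<noteq> g x \<longrightarrow> e \<le> norm (g y - g x)" if "x \<in> Y" for x
  proof (intro exI[of _ 1] conjI allI impI)
    fix y assume y: "y \<in> Y \<and> g y \<noteq> g x"
    then have "g y - g x \<in> \<int>" using that assms(3) by auto
    then show "1 \<le> norm (g y - g x)" using y by (simp add: Ints_nonzero_abs_ge1)
  qed simp
  then have "g constant_on Y"
    by (intro continuous_discrete_range_constant assms) auto
  then show ?thesis using assms by (metis constant_on_def)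
qed

text \<open>The relatively closed sets \<open>Z - C\<close> and \<open>Z - B\<close> cover
  \<open>Z\<close>, and \<open>u\<close> vanishes where they meet, so the two branches glue.\<close>

lemma continuous_on_extend_by_zero:
  fixes u :: "'b::topological_space \<Rightarrow> real"
  assumes u: "continuous_on Z u"
    and B: "openin (top_of_set Z) B"
    and C: "openin (top_of_set Z) C" "B \<inter> C = {}"
    and zero: "\<And>y. y \<in> Z - B - C \<Longrightarrow> u y = 0"
  shows "continuous_on Z (\<lambda>y. if y \<in> B then u y else 0)"
proof -
  have sub: "B \<subseteq> Z" "C \<subseteq> Z" using B C openin_imp_subset by blast+
  have Z: "Z = (Z - C) \<union> (Z - B)" using C(2) sub by auto
  have cl: "closedin (top_of_set Z) (Z - C)" "closedin (top_of_set Z) (Z - B)"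
    using B C by (simp_all add: closedin_diff)
  have "continuous_on ((Z - C) \<union> (Z - B)) (\<lambda>y. if y \<in> B then u y else 0)"
  proof (rule continuous_on_cases_local)
    show "continuous_on (Z - C) u" using u continuous_on_subset by blast
  qed (use cl Z zero in auto)
  then show ?thesis using Z by simp
qed

section \<open>Lifts to the infinite cyclic covering\<close>

text \<open>The last two assumptions say that \<open>A\<close> is clopen in
  \<open>U \<inter> V\<close>. A cover by two sets has no triple overlaps, so no cocycle condition
  arises.\<close>

locale two_set_cocycle =
  fixes X :: "'a topology" and U V A :: "'a set"
  assumes open_U: "openin X U" and open_V: "openin X V"
    and cover: "U \<union> V = topspace X"
    and A_subset: "A \<subseteq> U \<inter> V"
    and open_A: "openin X A" and open_compl_A: "openin X (U \<inter> V - A)"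
begin

text \<open>\<open>m\<close> and \<open>n\<close> are the sheet numbers over \<open>U\<close> and over \<open>V\<close> of a lift of \<open>f\<close> to the covering of
  \<open>X\<close> glued from copies of \<open>U\<close> and \<open>V\<close> indexed by the integers.\<close>

definition lift :: "'b::topological_space set \<Rightarrow> ('b \<Rightarrow> 'a) \<Rightarrow> ('b \<Rightarrow> real) \<Rightarrow> ('b \<Rightarrow> real) \<Rightarrow> bool"
  where "lift Y f m n \<longleftrightarrow>
    continuous_on {y\<in>Y. f y \<in> U} m \<and> continuous_on {y\<in>Y. f y \<in> V} n \<and>
    (\<forall>y\<in>Y. f y \<in> U \<longrightarrow> m y \<in> \<int>) \<and> (\<forall>y\<in>Y. f y \<in> V \<longrightarrow> n y \<in> \<int>) \<and>
    (\<forall>y\<in>Y. f y \<in> U \<inter> V \<longrightarrow> m y = n y + of_bool (f y \<in> A))"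

lemma openin_preimage:
  assumes "continuous_map (top_of_set Y) X f" "openin X W"
  shows "openin (top_of_set Y) {y\<in>Y. f y \<in> W}"
  using openin_continuous_map_preimage[OF assms] by simp

lemma lift_pullback:
  assumes l: "lift Y f m n" and g: "continuous_on Z g" "g ` Z \<subseteq> Y"
    and h: "\<And>z. z \<in> Z \<Longrightarrow> h z = f (g z)"
  shows "lift Z h (m \<circ> g) (n \<circ> g)"
proof -
  have "continuous_on {z\<in>Z. h z \<in> W} (k \<circ> g)" if "continuous_on {y\<in>Y. f y \<in> W} k"
    for W and k :: "_ \<Rightarrow> real"
  proof (rule continuous_on_compose)
    show "continuous_on {z\<in>Z. h z \<in> W} g" using g(1) by (rule continuous_on_subset) auto
    show "continuous_on (g ` {z\<in>Z. h z \<in> W}) k"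
      using that by (rule continuous_on_subset) (use g(2) h in auto)
  qed
  then show ?thesis using l g(2) h unfolding lift_def by (auto simp: image_subset_iff)
qed

text \<open>On the overlap both lifts have the same jump, so \<open>m - m'\<close> and
  \<open>n - n'\<close> agree there and glue to a continuous integer-valued function on the
  connected set \<open>Y\<close>.\<close>

lemma lift_unique:
  assumes f: "continuous_map (top_of_set Y) X f" and Y: "connected Y"
    and l: "lift Y f m n" and l': "lift Y f m' n'"
    and xy: "x \<in> Y" "f x \<in> U" "y \<in> Y" "f y \<in> U"
  shows "m x - m' x = m y - m' y"
proof -
  let ?U = "{y\<in>Y. f y \<in> U}" and ?V = "{y\<in>Y. f y \<in> V}"
  define d where "d y = (if f y \<in> U then m y - m' y else n y - n' y)" for y
  have YUV: "Y = ?U \<union> ?V"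
    using continuous_map_image_subset_topspace[OF f] cover by fastforce
  have dV: "d y = n y - n' y" if "y \<in> ?V" for y
    using that l l' by (auto simp: d_def lift_def)
  have "continuous_on ?U d"
    by (rule continuous_on_eq[of _ "\<lambda>y. m y - m' y"])
       (use l l' in \<open>auto simp: d_def lift_def intro: continuous_on_diff\<close>)
  moreover have "continuous_on ?V d"
    by (rule continuous_on_eq[of _ "\<lambda>y. n y - n' y"])
       (use l l' dV in \<open>auto simp: lift_def intro: continuous_on_diff\<close>)
  ultimately have "continuous_on (?U \<union> ?V) d"
    using openin_preimage[OF f open_U] openin_preimage[OF f open_V]
    by (intro continuous_on_Un_local_open) (simp_all flip: YUV)
  then have "continuous_on Y d" using YUV by simp
  moreover have "d y \<in> \<int>" if "y \<in> Y" for y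
    using that l l' YUV by (auto simp: d_def lift_def)
  ultimately have "d x = d y"
    using Y xy by (intro constant_on_connected_Ints[of Y]) auto
  then show ?thesis using xy by (simp add: d_def)
qed

text \<open>Urysohn's lemma on \<open>Y\<close> (\<open>X\<close> need not be normal) turns the pulled back cocycle into a map to
  the circle; a continuous logarithm of this map yields the sheet numbers.\<close>

lemma lift_exists:
  fixes Y :: "'b::euclidean_space set"
  assumes f: "continuous_map (top_of_set Y) X f" and Y: "contractible Y"
  obtains m n where "lift Y f m n"
proof -
  let ?U = "{y\<in>Y. f y \<in> U}" and ?V = "{y\<in>Y. f y \<in> V}"
  let ?A = "{y\<in>Y. f y \<in> A}" and ?C = "{y\<in>Y. f y \<in> U \<inter> V - A}"
  have YUV: "Y = ?U \<union> ?V"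
    using continuous_map_image_subset_topspace[OF f] cover by fastforce
  have op: "openin (top_of_set Y) ?U" "openin (top_of_set Y) ?V"
    "openin (top_of_set Y) ?A" "openin (top_of_set Y) ?C"
    using openin_preimage[OF f] open_U open_V open_A open_compl_A by blast+
  have "closedin (top_of_set Y) (Y - ?U)" "closedin (top_of_set Y) (Y - ?V)"
    by (intro closedin_diff op closedin_self)+
  moreover have "(Y - ?U) \<inter> (Y - ?V) = {}" using YUV by blast
  ultimately obtain u :: "'b \<Rightarrow> real" where u: "continuous_on Y u"
      "\<And>y. y \<in> Y - ?U \<Longrightarrow> u y = 0" "\<And>y. y \<in> Y - ?V \<Longrightarrow> u y = 1"
    by (rule Urysohn_local[of Y "Y - ?U" "Y - ?V" 0 1]) blast
  \<comment> \<open>The cocycle becomes a coboundary over the reals: \<open>w - v\<close> is the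
    indicator of \<open>?A\<close>. Off \<open>?A\<close> and \<open>?C\<close>, points of
    \<open>?V\<close> lie outside \<open>?U\<close>, where \<open>u = 0\<close>, and points of
    \<open>?U\<close> lie outside \<open>?V\<close>, where \<open>u - 1 = 0\<close>; hence
    \<open>w\<close> is continuous on \<open>?V\<close> and \<open>v\<close> on
    \<open>?U\<close>.\<close>
  define w where "w y = (if y \<in> ?A then u y else 0)" for y
  define v where "v y = (if y \<in> ?A then u y - 1 else 0)" for y
  have opsub: "openin (top_of_set Z) ?A" "openin (top_of_set Z) ?C" if "Z = ?U \<or> Z = ?V" for Z
    using that op A_subset by (auto intro!: openin_subset_trans[of Y])
  have w: "continuous_on ?V w"
    unfolding w_def
  proof (rule continuous_on_extend_by_zero[where C = ?C])
    show "continuous_on ?V u" using u(1) by (rule continuous_on_subset) auto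
  qed (use u(2) opsub in auto)
  have v: "continuous_on ?U v"
    unfolding v_def
  proof (rule continuous_on_extend_by_zero[where C = ?C])
    show "continuous_on ?U (\<lambda>y. u y - 1)"
      by (intro continuous_intros continuous_on_subset[OF u(1)]) auto
  qed (use u(3) opsub in auto)
  have wv: "w y = v y + of_bool (y \<in> ?A)" for y by (simp add: w_def v_def)
  \<comment> \<open>As \<open>w\<close> and \<open>v\<close> differ by an integer, either one
    defines the same circle-valued map, which is therefore continuous on all of
    \<open>Y\<close>.\<close>
  define \<theta> where "\<theta> y = exp (2 * of_real pi * \<i> * of_real (w y))" for y
  have \<theta>v: "\<theta> y = exp (2 * of_real pi * \<i> * of_real (v y))" for y
    by (auto simp: \<theta>_def wv exp_add algebra_simps)
  have "continuous_on (?U \<union> ?V) \<theta>"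
  proof (rule continuous_on_Un_local_open)
    show "continuous_on ?V \<theta>" unfolding \<theta>_def by (intro continuous_intros w)
    show "continuous_on ?U \<theta>" unfolding \<theta>v by (intro continuous_intros v)
  qed (simp_all flip: YUV add: op)
  then have "continuous_on Y \<theta>" using YUV by simp
  then obtain g where g: "continuous_on Y g" "\<And>y. y \<in> Y \<Longrightarrow> \<theta> y = exp (g y)"
    using continuous_logarithm_on_contractible[of Y \<theta>] Y by (auto simp: \<theta>_def)
  have int: "Im (g y) / (2 * pi) - w y \<in> \<int>" if y: "y \<in> Y" for y
  proof -
    obtain k :: int where "g y = 2 * of_real pi * \<i> * of_real (w y) + (of_int (2 * k) * pi) * \<i>"
      using g(2)[OF y] unfolding \<theta>_def by (metis exp_eq)
    then have "Im (g y) = 2 * pi * w y + 2 * pi * of_int k" by simp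
    then have "Im (g y) / (2 * pi) - w y = of_int k" by (simp add: field_simps)
    then show ?thesis by simp
  qed
  \<comment> \<open>Subtracting \<open>v\<close> and \<open>w\<close> from one global real logarithm
    leaves integers whose difference is \<open>w - v\<close>, the indicator of
    \<open>?A\<close>.\<close>
  have "lift Y f (\<lambda>y. Im (g y) / (2 * pi) - v y) (\<lambda>y. Im (g y) / (2 * pi) - w y)"
    unfolding lift_def
  proof (intro conjI ballI impI)
    show "continuous_on ?U (\<lambda>y. Im (g y) / (2 * pi) - v y)"
      by (intro continuous_intros v continuous_on_subset[OF g(1)]) auto
    show "continuous_on ?V (\<lambda>y. Im (g y) / (2 * pi) - w y)"
      by (intro continuous_intros w continuous_on_subset[OF g(1)]) auto
    fix y assume y: "y \<in> Y"
    show n: "Im (g y) / (2 * pi) - w y \<in> \<int>" using int y .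
    show eq: "Im (g y) / (2 * pi) - v y = Im (g y) / (2 * pi) - w y + of_bool (f y \<in> A)"
      using y by (simp add: wv)
    show "Im (g y) / (2 * pi) - v y \<in> \<int>" unfolding eq using n by (intro Ints_add) auto
  qed
  then show ?thesis by (rule that)
qed

section \<open>Winding numbers of paths\<close>

text \<open>The net change of sheet along a lift. It is read off from \<open>m\<close>, so it is
  meaningful for paths with both ends in \<open>U\<close>; there \<open>lift_unique\<close> makes it
  independent of the lift.\<close>

definition winding :: "(real \<Rightarrow> 'a) \<Rightarrow> int" where
  "winding p = (THE k. \<exists>m n. lift {0..1} p m n \<and> m 1 - m 0 = of_int k)"

lemma winding_eq:
  assumes p: "pathin X p" "p 0 \<in> U" "p 1 \<in> U" and l: "lift {0..1} p m n"
  shows "of_int (winding p) = m 1 - m 0"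
proof -
  have "m 1 \<in> \<int>" "m 0 \<in> \<int>" using p l by (auto simp: lift_def)
  then obtain k where k: "m 1 - m 0 = of_int k" by (metis Ints_cases Ints_diff)
  have "winding p = k"
    unfolding winding_def
  proof (rule the_equality)
    show "\<exists>m n. lift {0..1} p m n \<and> m 1 - m 0 = of_int k" using l k by blast
    fix k' assume "\<exists>m n. lift {0..1} p m n \<and> m 1 - m 0 = of_int k'"
    then obtain m' n' where l': "lift {0..1} p m' n'" and k': "m' 1 - m' 0 = of_int k'" by blast
    have "m 0 - m' 0 = m 1 - m' 1"
      using p by (intro lift_unique[OF _ _ l l']) (auto simp: pathin_def)
    then show "k' = k" using k k' by linarith
  qed
  then show ?thesis using k by simp
qed

lemma lift_path_exists:
  assumes "pathin X p" obtains m n where "lift {0..1} p m n"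
  using lift_exists[of "{0..1}" p] assms
  by (auto simp: pathin_def convex_imp_contractible)

text \<open>Lift the homotopy over the whole square. It is constant, with value in \<open>U\<close>,
  on each of the edges \<open>s = 0\<close> and \<open>s = 1\<close>, so \<open>m\<close> is
  constant along them and the other two edges have equal sheet changes.\<close>

lemma winding_homotopic:
  assumes h: "path_homotopic X p q" and U: "p 0 \<in> U" "p 1 \<in> U"
  shows "winding p = winding q"
proof -
  obtain h where hc: "continuous_map (prod_topology (top_of_set {0..1::real}) (top_of_set {0..1::real})) X h"
    and hp: "\<And>s. s\<in>{0..1} \<Longrightarrow> h (0, s) = p s" and hq: "\<And>s. s\<in>{0..1} \<Longrightarrow> h (1, s) = q s"
    and h0: "\<And>t. t\<in>{0..1} \<Longrightarrow> h (t, 0) = p 0" and h1: "\<And>t. t\<in>{0..1} \<Longrightarrow> h (t, 1) = p 1"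
    using h unfolding path_homotopic by blast
  have "continuous_map (top_of_set ({0..1} \<times> {0..1})) X h"
    using hc by (simp flip: subtopology_Times)
  then obtain m n where l: "lift ({0..1} \<times> {0..1}) h m n"
    using lift_exists[of "{0..1} \<times> {0..1}" h] by (metis convex_Times convex_imp_contractible convex_real_interval(5))
  have edge: "m (0, s) = m (1, s)" if s: "s \<in> {0..1}" and c: "\<And>t. t \<in> {0..1} \<Longrightarrow> h (t, s) \<in> U" for s
  proof (rule constant_on_connected_Ints[of "{0..1}" "\<lambda>t. m (t, s)"])
    have "lift {0..1} (\<lambda>t. h (t, s)) (m \<circ> (\<lambda>t. (t, s))) (n \<circ> (\<lambda>t. (t, s)))"
      by (rule lift_pullback[OF l]) (use s in \<open>auto intro!: continuous_intros\<close>)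
    moreover have "{t \<in> {0..1}. h (t, s) \<in> U} = {0..1}" using c by auto
    ultimately show "continuous_on {0..1} (\<lambda>t. m (t, s))" "\<And>t. t \<in> {0..1} \<Longrightarrow> m (t, s) \<in> \<int>"
      using c by (simp_all add: lift_def o_def)
  qed auto
  have lp: "lift {0..1} p (m \<circ> Pair 0) (n \<circ> Pair 0)"
    by (rule lift_pullback[OF l]) (auto intro!: continuous_intros simp: hp)
  have lq: "lift {0..1} q (m \<circ> Pair 1) (n \<circ> Pair 1)"
    by (rule lift_pullback[OF l]) (auto intro!: continuous_intros simp: hq)
  have "of_int (winding p) = m (0, 1) - m (0, 0)"
    using winding_eq[OF path_homotopic_imp(1)[OF h] _ _ lp] U by simp
  also have "\<dots> = m (1, 1) - m (1, 0)"
    using edge[of 0] edge[of 1] h0 h1 U by simp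
  also have "\<dots> = of_int (winding q)"
    using winding_eq[OF path_homotopic_imp(2)[OF h] _ _ lq] U path_homotopic_imp(3,4)[OF h] by simp
  finally show ?thesis by simp
qed

lemma lift_join:
  assumes l: "lift {0..1} (join_paths p q) m n" and e: "p 1 = q 0"
  shows "lift {0..1} p (\<lambda>t. m (t / 2)) (\<lambda>t. n (t / 2))"
    and "lift {0..1} q (\<lambda>t. m ((t + 1) / 2)) (\<lambda>t. n ((t + 1) / 2))"
proof -
  have "lift {0..1} p (m \<circ> (\<lambda>t. t / 2)) (n \<circ> (\<lambda>t. t / 2))"
    by (rule lift_pullback[OF l]) (auto intro!: continuous_intros simp: join_paths_def)
  then show "lift {0..1} p (\<lambda>t. m (t / 2)) (\<lambda>t. n (t / 2))" by (simp add: o_def)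
  have "lift {0..1} q (m \<circ> (\<lambda>t. (t + 1) / 2)) (n \<circ> (\<lambda>t. (t + 1) / 2))"
  proof (rule lift_pullback[OF l])
    fix t :: real assume "t \<in> {0..1}"
    then show "q t = join_paths p q ((t + 1) / 2)"
      \<comment> \<open>At \<open>t = 0\<close> the argument is 1/2, where \<open>join_paths\<close>
        still follows \<open>p\<close>; the values match because \<open>p 1 = q 0\<close>.\<close>
      using e by (cases "t = 0") (auto simp: join_paths_def add_divide_distrib)
  qed (auto intro!: continuous_intros)
  then show "lift {0..1} q (\<lambda>t. m ((t + 1) / 2)) (\<lambda>t. n ((t + 1) / 2))" by (simp add: o_def)
qed

text \<open>A lift of the concatenation restricts to lifts of both halves, and the sheet changes
  telescope at 1/2.\<close>

lemma winding_join:
  assumes p: "pathin X p" "p 0 \<in> U" "p 1 \<in> U" and q: "pathin X q" "q 1 \<in> U" and e: "p 1 = q 0"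
  shows "winding (join_paths p q) = winding p + winding q"
proof -
  have j: "pathin X (join_paths p q)" using pathin_join p q e by blast
  obtain m n where l: "lift {0..1} (join_paths p q) m n" using lift_path_exists[OF j] .
  have "of_int (winding (join_paths p q)) = m 1 - m 0"
    using winding_eq[OF j _ _ l] p q by (simp add: join_paths_def)
  moreover have "of_int (winding p) = m (1/2) - m 0"
    using winding_eq[OF p lift_join(1)[OF l e]] by simp
  moreover have "of_int (winding q) = m 1 - m (1/2)"
    using winding_eq[OF q(1) _ q(2) lift_join(2)[OF l e]] p e by simp
  ultimately show ?thesis by linarith
qed

lemma winding_in_hom:
  assumes a: "a \<in> U"
  obtains r where "r \<in> hom (fundamental_group X a) integer_group"
    and "\<And>p. p \<in> loops_at X a \<Longrightarrow> r (loop_rel X a `` {p}) = winding p"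
proof -
  \<comment> \<open>Any representative will do, by homotopy invariance of
    \<open>winding\<close>.\<close>
  define r where "r C = winding (SOME p. p \<in> C)" for C
  have r: "r (loop_rel X a `` {p}) = winding p" if p: "p \<in> loops_at X a" for p
  proof -
    have "p \<in> loop_rel X a `` {p}" using equiv_class_self[OF equiv_loop_rel p] .
    then have "(SOME q. q \<in> loop_rel X a `` {p}) \<in> loop_rel X a `` {p}"
      by (rule someI[of "\<lambda>q. q \<in> loop_rel X a `` {p}"])
    then have "path_homotopic X p (SOME q. q \<in> loop_rel X a `` {p})"
      unfolding loop_rel_def by blast
    then show ?thesis
      using winding_homotopic p a by (simp add: r_def loops_at_def)
  qed
  have "r \<in> hom (fundamental_group X a) integer_group"
  proof (rule homI)
    fix C C' assume "C \<in> carrier (fundamental_group X a)" "C' \<in> carrier (fundamental_group X a)"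
    then obtain p q where pq: "p \<in> loops_at X a" "q \<in> loops_at X a"
      and C: "C = loop_rel X a `` {p}" "C' = loop_rel X a `` {q}"
      by (auto simp: fundamental_group_def quotient_def)
    have "winding (join_paths p q) = winding p + winding q"
      using pq a by (intro winding_join) (auto simp: loops_at_def)
    then show "r (C \<otimes>\<^bsub>fundamental_group X a\<^esub> C') = r C \<otimes>\<^bsub>integer_group\<^esub> r C'"
      by (simp add: C pq fundamental_group_mult join_in_loops r)
  qed simp
  then show ?thesis using r that by blast
qed

text \<open>Along \<open>p\<close> the number \<open>m\<close> is constant, along \<open>q\<close>
  the number \<open>n\<close> is. At \<open>b\<close>, outside \<open>A\<close>, the two agree; at
  the final \<open>a\<close>, inside \<open>A\<close>, \<open>m\<close> exceeds \<open>n\<close> by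
  1.\<close>

lemma winding_crossing_loop:
  assumes p: "pathin (subtopology X U) p" and q: "pathin (subtopology X V) q"
    and e: "p 0 = a" "p 1 = b" "q 0 = b" "q 1 = a"
    and a: "a \<in> A" and b: "b \<notin> A"
  shows "winding (join_paths p q) = 1"
proof -
  have pX: "pathin X p" "\<And>t. t \<in> {0..1} \<Longrightarrow> p t \<in> U"
    using p by (auto simp: pathin_def continuous_map_in_subtopology)
  have qX: "pathin X q" "\<And>t. t \<in> {0..1} \<Longrightarrow> q t \<in> V"
    using q by (auto simp: pathin_def continuous_map_in_subtopology)
  have aUV: "a \<in> U \<inter> V" using a A_subset by blast
  have bUV: "b \<in> U \<inter> V" using pX(2)[of 1] qX(2)[of 0] e by auto
  have j: "pathin X (join_paths p q)" using pathin_join pX(1) qX(1) e by metis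
  have je: "join_paths p q 0 = a" "join_paths p q (1/2) = b" "join_paths p q 1 = a"
    using e by (simp_all add: join_paths_def)
  obtain m n where l: "lift {0..1} (join_paths p q) m n" using lift_path_exists[OF j] .
  have pq: "p 1 = q 0" using e by simp
  have "{t\<in>{0..1}. p t \<in> U} = {0..1}" "{t\<in>{0..1}. q t \<in> V} = {0..1}" using pX qX by auto
  then have c: "continuous_on {0..1} (\<lambda>t. m (t / 2))" "\<And>t. t \<in> {0..1} \<Longrightarrow> m (t / 2) \<in> \<int>"
    "continuous_on {0..1} (\<lambda>t. n ((t + 1) / 2))" "\<And>t. t \<in> {0..1} \<Longrightarrow> n ((t + 1) / 2) \<in> \<int>"
    using lift_join[OF l pq] pX(2) qX(2) unfolding lift_def by auto
  have "m 0 = m (1/2)"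
    using constant_on_connected_Ints[OF _ c(1,2), of 0 1] by simp
  moreover have "n (1/2) = n 1"
    using constant_on_connected_Ints[OF _ c(3,4), of 0 1] by simp
  moreover have "m (1/2) = n (1/2)" "m 1 = n 1 + 1"
    using l aUV bUV a b je unfolding lift_def by force+
  moreover have "of_int (winding (join_paths p q)) = m 1 - m 0"
    using winding_eq[OF j _ _ l] je aUV by simp
  ultimately show ?thesis by linarith
qed

section \<open>Splitting off the integers\<close>

text \<open>The powers of the class of the crossing loop embed the integers; the winding
  homomorphism sends that class to 1 and so is a left inverse.\<close>

lemma integer_group_retract_of_fundamental_group:
  assumes p: "pathin (subtopology X U) p" and q: "pathin (subtopology X V) q"
    and e: "p 0 = a" "p 1 = b" "q 0 = b" "q 1 = a"
    and a: "a \<in> A" and b: "b \<notin> A"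
  shows "group_retract_of integer_group (fundamental_group X a)"
proof -
  let ?G = "fundamental_group X a"
  let ?c = "join_paths p q"
  define C where "C = loop_rel X a `` {?c}"
  have aU: "a \<in> U" using a A_subset by blast
  have G: "group ?G"
    using aU cover by (intro group_fundamental_group) auto
  have "pathin X ?c"
    using pathin_join[of X p q] p q e by (simp add: pathin_def continuous_map_in_subtopology)
  then have c: "?c \<in> loops_at X a"
    using e by (simp add: loops_at_def join_paths_def)
  then have C: "C \<in> carrier ?G"
    by (auto simp: C_def fundamental_group_def quotient_def)
  obtain r where r: "r \<in> hom ?G integer_group"
      "\<And>p. p \<in> loops_at X a \<Longrightarrow> r (loop_rel X a `` {p}) = winding p"
    using winding_in_hom[OF aU] by blast
  have "r C = 1"
    using r(2)[OF c] winding_crossing_loop[OF assms] by (simp add: C_def)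
  then have "r (C [^]\<^bsub>?G\<^esub> z) = z" for z :: int
    using hom_int_pow[OF r(1) C G, of z] by simp
  then show ?thesis
    unfolding group_retract_of_def using group.hom_integer_group_pow[OF G C] r(1) by blast
qed

end

section \<open>From a failure of separation to a crossing loop\<close>

theorem proposition4p1:
  fixes X :: "'a topology"
  assumes "path_connected_space X"
    and "locally_path_connected_space X"
    and "\<And>x. x \<in> topspace X \<Longrightarrow> \<not> group_retract_of integer_group (fundamental_group X x)"
  shows "phragmen_brouwer X"
  unfolding phragmen_brouwer_def
proof (intro conjI allI impI; (elim conjE)?)
  show "connected_space X"
    using assms(1) by (rule path_connected_imp_connected_space)
  fix D E a b
  assume D: "closedin X D" and E: "closedin X E" and disj: "D \<inter> E = {}"
    and a: "a \<in> topspace X - (D \<union> E)" and b: "b \<in> topspace X - (D \<union> E)"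
    and cD: "connected_component_of (subtopology X (topspace X - D)) a b"
    and cE: "connected_component_of (subtopology X (topspace X - E)) a b"
  define U where "U = topspace X - D"
  define V where "V = topspace X - E"
  have UV: "U \<inter> V = topspace X - (D \<union> E)" by (auto simp: U_def V_def)
  define A where "A = connected_component_of_set (subtopology X (U \<inter> V)) a"
  have open_U: "openin X U" and open_V: "openin X V" using D E by (auto simp: U_def V_def)
  then have open_UV: "openin X (U \<inter> V)" by blast
  \<comment> \<open>Open subsets inherit local path-connectedness, so their components are path
    components.\<close>
  have path: "\<exists>g. pathin (subtopology X W) g \<and> g 0 = x \<and> g 1 = y"
    if "openin X W" "connected_component_of (subtopology X W) x y" for W x y
    using path_component_eq_connected_component_of[OF
        locally_path_connected_space_open_subset[OF assms(2) that(1)], of x] that(2)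
    unfolding path_component_of_def by blast
  obtain p where p: "pathin (subtopology X U) p" "p 0 = a" "p 1 = b"
    using path[OF open_U] cD unfolding U_def by blast
  obtain q where q: "pathin (subtopology X V) q" "q 0 = b" "q 1 = a"
    using path[OF open_V] cE unfolding V_def by (metis connected_component_of_sym)
  \<comment> \<open>This makes the component \<open>A\<close> open in the overlap; as a component it
    is also closed there.\<close>
  have lc: "locally_connected_space (subtopology X (U \<inter> V))"
    using locally_path_connected_space_open_subset[OF assms(2) open_UV]
    by (rule locally_path_connected_imp_locally_connected_space)
  show "connected_component_of (subtopology X (topspace X - (D \<union> E))) a b"
  proof (rule ccontr)
    assume "\<not> ?thesis"
    then have bA: "b \<notin> A" by (simp add: A_def UV)
    have aA: "a \<in> A" using a by (simp add: A_def UV connected_component_of_refl)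
    interpret two_set_cocycle X U V A
    proof
      show "U \<union> V = topspace X" using disj by (auto simp: U_def V_def)
      show "A \<subseteq> U \<inter> V"
        using connected_component_of_subset_topspace[of "subtopology X (U \<inter> V)" a]
        by (auto simp: A_def)
      show "openin X A"
        using openin_connected_component_of_locally_connected_space[OF lc] open_UV
        unfolding A_def by (rule openin_trans_full)
      have "openin (subtopology X (U \<inter> V)) (topspace (subtopology X (U \<inter> V)) - A)"
        unfolding A_def by (intro openin_diff openin_topspace closedin_connected_component_of)
      moreover have "topspace (subtopology X (U \<inter> V)) = U \<inter> V"
        using openin_subset[OF open_UV] by (rule topspace_subtopology_subset)
      ultimately show "openin X (U \<inter> V - A)"
        using open_UV openin_trans_full[of X "U \<inter> V" "U \<inter> V - A"] by simp
    qed (fact open_U open_V)+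
    have "group_retract_of integer_group (fundamental_group X a)"
      using integer_group_retract_of_fundamental_group[OF p(1) q(1) p(2,3) q(2,3) aA bA] .
    then show False using assms(3) a by blast
  qed
qed

end
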